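(* Let $k\ge 2$. Let $\varphi:\Sigma^*\to\Sigma^*$ be a primitive morphism with an aperiodic infinite fixed point $w=\varphi(w)$, let $L=L_\varphi$ be its subshift, and suppose that $L$ is separable and that $\varphi$ is order-preserving on $L$. If $\varphi$ is $k$-uniform (i.e. $|\varphi(a)|=k$ for every letter $a\in\Sigma$), then the sequence $\nu_w=(\nu(\sigma^n(w)))_{n\ge0}$ is $k$-regular.
   Context: $\Sigma$ is a finite ordered alphabet; finite and infinite words (indexed from $0$) are ordered lexicographically, and $\sigma$ is the shift erasing the first symbol. A morphism preserves concatenation. $\varphi$ is primitive if for some $n$ every letter occurs in $\varphi^n(b)$ for every letter $b$. $L=L_\varphi$ is the closure of the $\sigma$-orbit of an infinite fixed point of $\varphi$ (independent of the fixed point for primitive $\varphi$); it is minimal and uniquely ergodic with shift-invariant probability measure $\mu$. An infinite word is aperiodic if it is not ultimately periodic. $\varphi$ is order-preserving on $L$ if for all $u,v\in L$: $u<v$ iff $\varphi(u)<\varphi(v)$. Each $u\in L$ can be written as $u=\sigma^p(\varphi(u'))$ with $u'\in L$, $0\le p<|\varphi(u'[0])|$. If the pair $(u',p)$ is unique, the type of $u$ is $\tau(u)=(u'[0],p)$. $L$ is separable if every $u\in L$ has a type and the $\sum_{a\in\Sigma}|\varphi(a)|$ possible types can be totally ordered so that $\tau(u)<\tau(v)$ implies $u<v$ for all $u,v\in L$. For $v\in L$, $\nu(v)=\mu(\{x\in L: w_{\min}\le x\le v\})\in[0,1]$, where $w_{\min}$ is the lexicographically least element of $L$. Here $\nu_w$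 is regarded as a sequence of real numbers. A sequence of real numbers $(s(n))_{n\ge0}$ is $k$-regular (over $\mathbb Q$) if the $\mathbb Q$-vector space spanned by its $k$-kernel $\{(s(k^e n+r))_{n\ge0}: e\ge0,\ 0\le r<k^e\}$ is finite-dimensional. *)

theory Defs
  imports
    "HOL-Probability.Probability"
    "HOL-Library.Fun_Lexorder"
    "HOL-Library.Function_Algebras"
    "HOL-Library.Omega_Words_Fun"
begin

text \<open>
  The alphabet is a type of class \<open>{finite, linorder}\<close>; infinite words are functions
  \<open>nat \<Rightarrow> 'a\<close> (type \<open>'a word\<close>), the shift is \<open>suffix 1\<close>, and \<^const>\<open>less_fun\<close> is the strict
  lexicographic order on infinite words.
\<close>

subsection \<open>Morphisms\<close>

definition morphism :: "('a list \<Rightarrow> 'a list) \<Rightarrow> bool" where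
  "morphism \<phi> \<longleftrightarrow> (\<forall>u v. \<phi> (u @ v) = \<phi> u @ \<phi> v)"

definition uniform_morphism :: "nat \<Rightarrow> ('a list \<Rightarrow> 'a list) \<Rightarrow> bool" where
  "uniform_morphism k \<phi> \<longleftrightarrow> (\<forall>a. length (\<phi> [a]) = k)"

definition primitive_morphism :: "('a list \<Rightarrow> 'a list) \<Rightarrow> bool" where
  "primitive_morphism \<phi> \<longleftrightarrow> (\<exists>n. \<forall>a b. a \<in> set ((\<phi> ^^ n) [b]))"

text \<open>
  The extension of a morphism to infinite words, for morphisms that erase no letter: then the
  image of the prefix of length \<open>n + 1\<close> has length at least \<open>n + 1\<close>.
\<close>

definition morph_word :: "('a list \<Rightarrow> 'a list) \<Rightarrow> 'a word \<Rightarrow> 'a word" where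
  "morph_word \<phi> u = (\<lambda>n. \<phi> (prefix (Suc n) u) ! n)"

lemma length_morphism_ge:
  assumes "morphism \<phi>" and "\<And>a. \<phi> [a] \<noteq> []"
  shows "length xs \<le> length (\<phi> xs)"
proof (induction xs)
  case (Cons a xs)
  have "\<phi> (a # xs) = \<phi> [a] @ \<phi> xs"
    using assms(1) unfolding morphism_def by (metis append_Cons append_Nil)
  moreover have "length (\<phi> [a]) \<ge> 1"
    using assms(2)[of a] by (simp add: Suc_le_eq)
  ultimately show ?case
    using Cons.IH by simp
qed simp

lemma prefix_morph_word:
  assumes "morphism \<phi>" and "\<And>a. \<phi> [a] \<noteq> []"
  shows "prefix (length (\<phi> (prefix n u))) (morph_word \<phi> u) = \<phi> (prefix n u)"
proof (rule nth_equalityI)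
  fix i assume "i < length (prefix (length (\<phi> (prefix n u))) (morph_word \<phi> u))"
  hence i: "i < length (\<phi> (prefix n u))"
    by (simp add: subsequence_def)
  have split: "\<phi> (prefix (m + d) u) = \<phi> (prefix m u) @ \<phi> (subsequence u m (m + d))" for m d
    using assms(1) unfolding morphism_def subsequence_def
    by (metis add_0 map_append upt_add_eq_append zero_le)
  have i': "i < length (\<phi> (prefix (Suc i) u))"
    using length_morphism_ge[OF assms, of "prefix (Suc i) u"] by (simp add: subsequence_def)
  have "\<phi> (prefix (Suc i) u) ! i = \<phi> (prefix n u) ! i"
  proof (cases "n \<le> Suc i")
    case True
    then obtain d where "Suc i = n + d" using le_Suc_ex by blast
    then show ?thesis using split[of n d] i by (simp add: nth_append)
  next
    case False
    then obtain d where "n = Suc i + d" using le_Suc_ex by (metis nat_le_linear)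
    then show ?thesis using split[of "Suc i" d] i' by (simp add: nth_append)
  qed
  then show "prefix (length (\<phi> (prefix n u))) (morph_word \<phi> u) ! i = \<phi> (prefix n u) ! i"
    using i by (simp add: subsequence_def morph_word_def)
qed (simp add: subsequence_def)

definition order_preserving_on :: "('a::linorder list \<Rightarrow> 'a list) \<Rightarrow> 'a word set \<Rightarrow> bool" where
  "order_preserving_on \<phi> L \<longleftrightarrow>
     (\<forall>u\<in>L. \<forall>v\<in>L. less_fun u v \<longleftrightarrow> less_fun (morph_word \<phi> u) (morph_word \<phi> v))"

subsection \<open>Infinite words and subshifts\<close>

definition ultimately_periodic :: "'a word \<Rightarrow> bool" where
  "ultimately_periodic u \<longleftrightarrow> (\<exists>p>0. \<exists>N. \<forall>n\<ge>N. u (n + p) = u n)"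

definition orbit_closure :: "'a word \<Rightarrow> 'a word set" where
  "orbit_closure w =
     product_topology (\<lambda>_. discrete_topology UNIV) UNIV closure_of range (\<lambda>n. suffix n w)"

subsection \<open>Types and separability\<close>

definition desubst :: "('a list \<Rightarrow> 'a list) \<Rightarrow> 'a word set \<Rightarrow> 'a word \<Rightarrow> 'a word \<times> nat \<Rightarrow> bool" where
  "desubst \<phi> L u = (\<lambda>(u', p). u' \<in> L \<and> p < length (\<phi> [u' 0]) \<and> u = suffix p (morph_word \<phi> u'))"

definition has_type :: "('a list \<Rightarrow> 'a list) \<Rightarrow> 'a word set \<Rightarrow> 'a word \<Rightarrow> bool" where
  "has_type \<phi> L u \<longleftrightarrow> (\<exists>!x. desubst \<phi> L u x)"

definition word_type :: "('a list \<Rightarrow> 'a list) \<Rightarrow> 'a word set \<Rightarrow> 'a word \<Rightarrow> 'a \<times> nat" where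
  "word_type \<phi> L u = (let (u', p) = (THE x. desubst \<phi> L u x) in (u' 0, p))"

definition separable :: "('a::linorder list \<Rightarrow> 'a list) \<Rightarrow> 'a word set \<Rightarrow> bool" where
  "separable \<phi> L \<longleftrightarrow>
     (\<forall>u\<in>L. has_type \<phi> L u) \<and>
     (\<exists>r. strict_linear_order_on {(a, p). p < length (\<phi> [a])} r \<and>
          (\<forall>u\<in>L. \<forall>v\<in>L. (word_type \<phi> L u, word_type \<phi> L v) \<in> r \<longrightarrow> less_fun u v))"

subsection \<open>Invariant measures\<close>

text \<open>
  Over a finite alphabet the product \<open>\<sigma>\<close>-algebra is the Borel \<open>\<sigma>\<close>-algebra of the
  product topology.
\<close>

definition invariant_prob :: "'a word set \<Rightarrow> 'a word measure \<Rightarrow> bool" where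
  "invariant_prob L \<mu> \<longleftrightarrow>
     prob_space \<mu> \<and>
     sets \<mu> = sets (restrict_space (Pi\<^sub>M UNIV (\<lambda>_. count_space UNIV)) L) \<and>
     distr \<mu> \<mu> (suffix 1) = \<mu>"

definition least_word :: "'a::linorder word set \<Rightarrow> 'a word" where
  "least_word L = (THE x. x \<in> L \<and> (\<forall>y\<in>L. x = y \<or> less_fun x y))"

definition nu :: "'a::linorder word set \<Rightarrow> 'a word measure \<Rightarrow> 'a word \<Rightarrow> real" where
  "nu L \<mu> v = measure \<mu>
     {x \<in> L. (least_word L = x \<or> less_fun (least_word L) x) \<and> (x = v \<or> less_fun x v)}"

subsection \<open>Regular sequences\<close>

interpretation rat_seq: vector_space "\<lambda>(q::rat) (s::nat \<Rightarrow> real) n. of_rat q * s n"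
  by standard (auto simp: fun_eq_iff algebra_simps of_rat_add of_rat_mult)

definition kernel :: "nat \<Rightarrow> (nat \<Rightarrow> real) \<Rightarrow> (nat \<Rightarrow> real) set" where
  "kernel k s = {(\<lambda>n. s (k ^ e * n + r)) | e r. r < k ^ e}"

definition regular_seq :: "nat \<Rightarrow> (nat \<Rightarrow> real) \<Rightarrow> bool" where
  "regular_seq k s \<longleftrightarrow> (\<exists>B. finite B \<and> rat_seq.span B = rat_seq.span (kernel k s))"

end

theory Submission
  imports Defs
begin

text \<open>
  Let \<open>F\<close> be the extension of \<open>\<phi>\<close> to infinite words. By separability the pieces
  \<open>\<sigma>\<^sup>p (F A)\<close>, \<open>p < k\<close>, are disjoint, and shift invariance gives them equal measure. The numbers
  \<open>k\<^sup>m \<mu>(F\<^sup>m [a])\<close> form probability vectors linked by the normalised incidence matrix, which is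
  primitive, so they do not depend on \<open>m\<close>; this replaces unique ergodicity. The pieces of level
  \<open>m\<close> are convex for the lexicographic order, so \<open>{x \<le> v}\<close> is approximated by unions of them and
  \<open>\<mu>(\<sigma>\<^sup>p F {x \<le> v}) = \<mu>{x \<le> v} / k\<close>. Hence \<open>\<nu>(\<sigma>\<^sup>p F v) - \<nu>(v) / k\<close> depends only on \<open>v 0\<close> and \<open>p\<close>.
  Since \<open>w (k n + p)\<close> is determined by \<open>w n\<close> and \<open>p\<close>, the sequence \<open>\<nu>\<^sub>w\<close> together with finitely many
  multiples of indicators of \<open>w n = b\<close> spans a space containing the kernel.
\<close>

subsection \<open>Closed sets of infinite words\<close>

text \<open>Closedness in the product of discrete topologies.\<close>

definition cyl_closed :: "'a word set \<Rightarrow> bool" where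
  "cyl_closed A \<longleftrightarrow> (\<forall>x. (\<forall>n. \<exists>y\<in>A. \<forall>i<n. x i = y i) \<longrightarrow> x \<in> A)"

lemma cyl_closedI:
  "(\<And>x. (\<And>n. \<exists>y\<in>A. \<forall>i<n. x i = y i) \<Longrightarrow> x \<in> A) \<Longrightarrow> cyl_closed A"
  unfolding cyl_closed_def by blast

lemma cyl_closedD: "cyl_closed A \<Longrightarrow> (\<And>n. \<exists>y\<in>A. \<forall>i<n. x i = y i) \<Longrightarrow> x \<in> A"
  unfolding cyl_closed_def by blast

lemma cyl_closed_Int:
  assumes "cyl_closed A" "cyl_closed B"
  shows "cyl_closed (A \<inter> B)"
proof (rule cyl_closedI)
  fix x assume x: "\<And>n. \<exists>y\<in>A \<inter> B. \<forall>i<n. x i = y i"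
  show "x \<in> A \<inter> B"
    by (intro IntI cyl_closedD[OF assms(1)] cyl_closedD[OF assms(2)]) (use x in blast)+
qed

lemma cyl_closed_first: "cyl_closed {x. P (x 0)}"
proof (rule cyl_closedI)
  fix x :: "'a word" assume "\<And>n. \<exists>y\<in>{x. P (x 0)}. \<forall>i<n. x i = y i"
  from this[of 1] show "x \<in> {x. P (x 0)}" by auto
qed

text \<open>A basic open set constrains only finitely many coordinates, so around a point it
  contains all words sharing a long enough prefix. Closure therefore becomes a condition on the
  factors of \<open>w\<close>.\<close>

lemma orbit_closure_iff:
  "x \<in> orbit_closure w \<longleftrightarrow> (\<forall>n. \<exists>j. \<forall>i<n. x i = w (j + i))"
proof
  assume x: "x \<in> orbit_closure w"
  show "\<forall>n. \<exists>j. \<forall>i<n. x i = w (j + i)"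
  proof
    fix n
    define U where "U = (\<Pi>\<^sub>E i\<in>UNIV. if i < n then {x i} else UNIV)"
    have "finite {i. (if i < n then {x i} else UNIV) \<noteq> (UNIV :: 'a set)}"
      by (rule finite_subset[of _ "{..<n}"]) auto
    hence "openin (product_topology (\<lambda>_. discrete_topology UNIV) UNIV) U"
      unfolding U_def by (intro product_topology_basis) auto
    moreover have "x \<in> U" by (auto simp: U_def)
    ultimately obtain y where "y \<in> range (\<lambda>n. suffix n w)" "y \<in> U"
      using x unfolding orbit_closure_def in_closure_of by metis
    then obtain j where "suffix j w \<in> U" by auto
    have "x i = w (j + i)" if "i < n" for i
      using PiE_mem[OF \<open>suffix j w \<in> U\<close>[unfolded U_def], of i] that by simp
    thus "\<exists>j. \<forall>i<n. x i = w (j + i)" by blast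
  qed
next
  assume x: "\<forall>n. \<exists>j. \<forall>i<n. x i = w (j + i)"
  show "x \<in> orbit_closure w"
    unfolding orbit_closure_def in_closure_of
  proof (intro conjI allI impI)
    show "x \<in> topspace (product_topology (\<lambda>_. discrete_topology UNIV) UNIV)" by simp
    fix T assume T: "x \<in> T \<and> openin (product_topology (\<lambda>_. discrete_topology UNIV) UNIV) T"
    then obtain U where fin: "finite {i. U i \<noteq> (UNIV::'a set)}"
      and xU: "x \<in> Pi\<^sub>E UNIV U" and UT: "Pi\<^sub>E UNIV U \<subseteq> T"
      unfolding openin_product_topology_alt by auto
    obtain n where n: "\<And>i. U i \<noteq> UNIV \<Longrightarrow> i < n"
      using fin unfolding finite_nat_set_iff_bounded by auto
    obtain j where j: "\<forall>i<n. x i = w (j + i)" using x by blast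
    have "suffix j w \<in> Pi\<^sub>E UNIV U"
    proof -
      have "suffix j w i \<in> U i" for i
        using n[of i] j Pi_mem[of x UNIV U i] xU by (cases "U i = UNIV") (auto simp: PiE_UNIV_domain)
      thus ?thesis by auto
    qed
    thus "\<exists>y. y \<in> range (\<lambda>n. suffix n w) \<and> y \<in> T"
      by (intro exI[of _ "suffix j w"] conjI rangeI subsetD[OF UT])
  qed
qed

lemma cyl_closed_orbit_closure: "cyl_closed (orbit_closure w)"
proof (rule cyl_closedI)
  fix x assume x: "\<And>n. \<exists>y\<in>orbit_closure w. \<forall>i<n. x i = y i"
  show "x \<in> orbit_closure w"
    unfolding orbit_closure_iff
  proof
    fix n
    obtain y where "y \<in> orbit_closure w" "\<forall>i<n. x i = y i" using x by blast
    thus "\<exists>j. \<forall>i<n. x i = w (j + i)" unfolding orbit_closure_iff by metis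
  qed
qed

lemma suffix_in_orbit_closure: "suffix n w \<in> orbit_closure w"
  unfolding orbit_closure_iff by auto

lemma orbit_closure_suffix: "x \<in> orbit_closure w \<Longrightarrow> suffix n x \<in> orbit_closure w"
  unfolding orbit_closure_iff
proof
  fix m assume "\<forall>n. \<exists>j. \<forall>i<n. x i = w (j + i)"
  then obtain j where "\<forall>i<n+m. x i = w (j + i)" by blast
  thus "\<exists>j. \<forall>i<m. suffix n x i = w (j + i)"
    by (intro exI[of _ "j + n"]) (auto simp: algebra_simps)
qed

text \<open>Over a finite alphabet there are finitely many prefixes of each length, so a closed set
  is a countable intersection of finite unions of cylinders.\<close>

lemma cyl_closed_measurable:
  fixes A :: "'a::finite word set"
  assumes "cyl_closed A"
  shows "A \<in> sets (Pi\<^sub>M UNIV (\<lambda>_. count_space UNIV))"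
proof -
  let ?M = "Pi\<^sub>M UNIV (\<lambda>_::nat. count_space (UNIV :: 'a set))"
  let ?C = "\<lambda>n xs. {x. \<forall>i<n. x i = xs ! i} :: 'a word set"
  have C: "?C n xs \<in> sets ?M" for n xs
  proof -
    have "?C n xs = {x \<in> space ?M. \<forall>i\<in>{..<n}. x i = xs ! i}" by (auto simp: space_PiM)
    also have "\<dots> \<in> sets ?M" by measurable
    finally show ?thesis .
  qed
  have "A = (\<Inter>n. \<Union>xs\<in>(\<lambda>y. prefix n y) ` A. ?C n xs)" (is "_ = ?R")
  proof
    show "A \<subseteq> ?R" by (auto simp: subsequence_def)
    show "?R \<subseteq> A"
      by (rule subsetI, rule cyl_closedD[OF assms]) (auto simp: subsequence_def)
  qed
  moreover have "finite ((\<lambda>y. prefix n y) ` A)" for n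
    by (rule finite_subset[OF _ finite_lists_length_eq[of UNIV n]]) auto
  hence "?R \<in> sets ?M"
    using C by (intro sets.countable_INT' sets.finite_UN image_subsetI) simp_all
  ultimately show ?thesis by simp
qed

text \<open>Compactness of the full shift, as existence of a cluster point: by the pigeonhole
  principle a prefix shared by infinitely many \<open>Y m\<close> extends by one letter with the
  same property.\<close>

lemma koenig:
  fixes Y :: "nat \<Rightarrow> 'a::finite word"
  obtains z where "\<And>n. infinite {m. \<forall>i<n. Y m i = z i}"
proof -
  have Y_fin: "finite ((\<lambda>m. Y m n) ` S)" for n S
    by (rule finite_subset[OF subset_UNIV finite])
  have "\<exists>f. \<forall>n. (length (f n) = n \<and> infinite {m. \<forall>i<n. Y m i = f n ! i})
              \<and> (\<exists>c. f (Suc n) = f n @ [c])"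
  proof (rule dependent_nat_choice, goal_cases)
    case 1
    show ?case by (rule exI[of _ "[]"]) simp
  next
    case (2 xs n)
    let ?S = "{m. \<forall>i<n. Y m i = xs ! i}"
    have "infinite ?S" using 2 by simp
    then obtain c where c: "infinite {m\<in>?S. Y m n = c}"
      using pigeonhole_infinite[of ?S "\<lambda>m. Y m n"] Y_fin by blast
    have "{m. \<forall>i<Suc n. Y m i = (xs @ [c]) ! i} = {m\<in>?S. Y m n = c}"
      using 2 by (auto simp: less_Suc_eq nth_append)
    thus ?case using 2 c by (intro exI[of _ "xs @ [c]"]) simp
  qed
  then obtain f where len: "\<And>n. length (f n) = n"
    and inf: "\<And>n. infinite {m. \<forall>i<n. Y m i = f n ! i}"
    and step: "\<And>n. \<exists>c. f (Suc n) = f n @ [c]" by blast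
  have pre: "i < n \<Longrightarrow> f n ! i = f (Suc i) ! i" for i n
  proof (induction n)
    case (Suc n)
    obtain c where "f (Suc n) = f n @ [c]" using step by blast
    thus ?case using Suc len[of n] by (cases "i = n") (auto simp: nth_append)
  qed simp
  show thesis
  proof
    fix n
    have "{m. \<forall>i<n. Y m i = f (Suc i) ! i} = {m. \<forall>i<n. Y m i = f n ! i}"
      by (rule Collect_cong) (metis pre)
    thus "infinite {m. \<forall>i<n. Y m i = f (Suc i) ! i}" using inf by simp
  qed
qed

section \<open>Lexicographic order and least elements of closed sets\<close>

lemma less_fun_linear:
  fixes x y :: "'a::linorder word"
  shows "x = y \<or> less_fun x y \<or> less_fun y x"
proof (cases "x = y")
  case False
  then obtain n where "x n \<noteq> y n" "\<forall>i<n. x i = y i"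
    using exists_least_iff[of "\<lambda>n. x n \<noteq> y n"] by auto
  thus ?thesis unfolding less_fun_def by (metis linorder_less_linear)
qed simp

lemma less_fun_same_prefix:
  fixes x y :: "'a::linorder word"
  assumes "\<And>i. i < p \<Longrightarrow> x i = y i"
  shows "less_fun (suffix p x) (suffix p y) \<longleftrightarrow> less_fun x y"
proof
  assume "less_fun (suffix p x) (suffix p y)"
  then obtain n where n: "x (p + n) < y (p + n)" "\<forall>i<n. x (p + i) = y (p + i)"
    by (auto simp: less_fun_def)
  have "x i = y i" if "i < p + n" for i
    using assms[of i] n(2)[rule_format, of "i - p"] that by (cases "i < p") auto
  thus "less_fun x y" using n(1) by (auto simp: less_fun_def)
next
  assume "less_fun x y"
  then obtain n where n: "x n < y n" "\<forall>i<n. x i = y i" by (auto simp: less_fun_def)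
  have "n \<ge> p" using assms[of n] n(1) by (metis leI order_less_irrefl)
  then obtain d where "n = p + d" using le_Suc_ex by blast
  thus "less_fun (suffix p x) (suffix p y)" using n unfolding less_fun_def
    by (intro exI[of _ d]) auto
qed

text \<open>A strict inequality is decided by a finite prefix, so \<open>less_fun v x\<close> would
  pass to the words approximating \<open>x\<close>.\<close>

lemma cyl_closed_atMost: "cyl_closed {x. x = v \<or> less_fun x (v :: 'a::linorder word)}"
proof (rule cyl_closedI)
  fix x assume x: "\<And>n. \<exists>y\<in>{x. x = v \<or> less_fun x v}. \<forall>i<n. x i = y i"
  have "\<not> less_fun v x"
  proof
    assume "less_fun v x"
    then obtain n where n: "v n < x n" "\<forall>i<n. v i = x i" by (auto simp: less_fun_def)
    obtain y where y: "y = v \<or> less_fun y v" "\<forall>i<Suc n. x i = y i" using x by blast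
    hence "less_fun v y" using n by (auto simp: less_fun_def intro!: exI[of _ n])
    thus False using y less_fun_asym less_fun_irrefl by blast
  qed
  thus "x \<in> {x. x = v \<or> less_fun x v}" using less_fun_linear by blast
qed

text \<open>The candidate minimum: at each position the least letter among the elements that share
  the prefix chosen so far. Ranging over the set \<open>{..<n}\<close> keeps the recursive calls
  visibly at smaller positions.\<close>

fun greedy_word :: "'a::linorder word set \<Rightarrow> nat \<Rightarrow> 'a" where
  "greedy_word A n = Min ((\<lambda>y. y n) ` {y\<in>A. \<forall>i\<in>{..<n}. y i = greedy_word A i})"

declare greedy_word.simps [simp del]

text \<open>Every prefix of the greedy word is a prefix of an element of \<open>A\<close>, so
  closedness puts the word itself into \<open>A\<close>. This is what lets \<open>nu\<close> be
  rewritten as the measure of an initial segment.\<close>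

lemma least_word_le:
  fixes A :: "'a::{finite, linorder} word set"
  assumes "cyl_closed A" "A \<noteq> {}" "y \<in> A"
  shows "least_word A = y \<or> less_fun (least_word A) y"
proof -
  let ?z = "greedy_word A"
  have ex: "\<exists>y\<in>A. \<forall>i<n. ?z i = y i" for n
  proof (induction n)
    case 0
    thus ?case using assms by blast
  next
    case (Suc n)
    let ?S = "(\<lambda>y. y n) ` {y\<in>A. \<forall>i\<in>{..<n}. y i = ?z i}"
    have "?S \<noteq> {}" using Suc by force
    hence "Min ?S \<in> ?S" by (intro Min_in) auto
    hence "?z n \<in> ?S" by (simp only: greedy_word.simps[of A n])
    then obtain y where "y \<in> A" "\<forall>i<n. ?z i = y i" "?z n = y n" by auto
    thus ?case by (metis less_Suc_eq)
  qed
  hence zA: "?z \<in> A" by (intro cyl_closedD[OF assms(1)])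
  have zle: "?z = y \<or> less_fun ?z y" if "y \<in> A" for y
  proof -
    have "\<not> less_fun y ?z"
    proof
      assume "less_fun y ?z"
      then obtain n where n: "y n < ?z n" "\<forall>i<n. y i = ?z i" by (auto simp: less_fun_def)
      have "?z n \<le> y n"
        unfolding greedy_word.simps[of A n] by (intro Min_le imageI) (use n(2) that in simp_all)
      thus False using n(1) by simp
    qed
    thus ?thesis using less_fun_linear by blast
  qed
  have "least_word A = ?z"
    unfolding least_word_def
  proof (rule the_equality)
    show "?z \<in> A \<and> (\<forall>y\<in>A. ?z = y \<or> less_fun ?z y)" using zA zle by blast
    fix x assume "x \<in> A \<and> (\<forall>y\<in>A. x = y \<or> less_fun x y)"
    thus "x = ?z" using zA zle less_fun_asym by metis
  qed
  thus ?thesis using zle assms(3) by simp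
qed

subsection \<open>Desubstitution\<close>

locale invariant_measure =
  fixes L :: "'a::finite word set" and \<mu> :: "'a word measure"
  assumes invariant: "invariant_prob L \<mu>"
    and L_closed: "cyl_closed L"
    and L_suffix: "x \<in> L \<Longrightarrow> suffix n x \<in> L"
begin

sublocale prob_space \<mu>
  using invariant by (simp add: invariant_prob_def)

lemma sets_\<mu>: "sets \<mu> = sets (restrict_space (Pi\<^sub>M UNIV (\<lambda>_. count_space UNIV)) L)"
  using invariant by (simp add: invariant_prob_def)

lemma space_\<mu>: "space \<mu> = L"
  using sets_eq_imp_space_eq[OF sets_\<mu>] by (simp add: space_restrict_space space_PiM)

lemma closed_sets: "cyl_closed A \<Longrightarrow> A \<subseteq> L \<Longrightarrow> A \<in> sets \<mu>"
  unfolding sets_\<mu> sets_restrict_space using cyl_closed_measurable by blast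

lemma measurable_suffix: "suffix 1 \<in> measurable \<mu> \<mu>"
proof -
  let ?M = "Pi\<^sub>M UNIV (\<lambda>_::nat. count_space (UNIV :: 'a set))"
  have "suffix 1 \<in> measurable ?M ?M"
    unfolding suffix_def by (rule measurable_PiM_single') (auto simp: space_PiM)
  hence "suffix 1 \<in> measurable (restrict_space ?M L) (restrict_space ?M L)"
    by (intro measurable_restrict_space3) (auto simp: L_suffix)
  thus ?thesis by (simp add: measurable_cong_sets[OF sets_\<mu> sets_\<mu>])
qed

lemma measure_suffix_vimage:
  assumes "A \<in> sets \<mu>"
  shows "measure \<mu> {x\<in>L. suffix 1 x \<in> A} = measure \<mu> A"
proof -
  have "measure \<mu> A = measure (distr \<mu> \<mu> (suffix 1)) A"
    using invariant by (simp add: invariant_prob_def)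
  also have "\<dots> = measure \<mu> (suffix 1 -` A \<inter> space \<mu>)"
    by (rule measure_distr[OF measurable_suffix assms])
  also have "suffix 1 -` A \<inter> space \<mu> = {x\<in>L. suffix 1 x \<in> A}"
    by (auto simp: space_\<mu>)
  finally show ?thesis by simp
qed

end

section \<open>Shifted images of sets under an abstract uniform substitution\<close>

definition piece :: "('a word \<Rightarrow> 'a word) \<Rightarrow> nat \<Rightarrow> 'a word set \<Rightarrow> 'a word set" where
  "piece F p A = (\<lambda>u. suffix p (F u)) ` A"

lemma pieceI: "u \<in> A \<Longrightarrow> x = suffix p (F u) \<Longrightarrow> x \<in> piece F p A"
  by (auto simp: piece_def)

lemma pieceE:
  assumes "x \<in> piece F p A" obtains u where "u \<in> A" "x = suffix p (F u)"
  using assms by (auto simp: piece_def)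

text \<open>Stated for a map on infinite words rather than for a morphism, so that
  \<open>F ^^ m\<close> with \<open>K ^ m\<close> is again an instance and all results hold at every
  level. \<open>F_local\<close> encodes uniformity: block \<open>j\<close> of the image depends only
  on letter \<open>j\<close>.\<close>

locale desubstitution = invariant_measure +
  fixes K :: nat and F :: "'a word \<Rightarrow> 'a word"
  assumes K_pos: "0 < K"
    and F_L: "u \<in> L \<Longrightarrow> F u \<in> L"
    and F_local: "u (i div K) = v (i div K) \<Longrightarrow> F u i = F v i"
    and F_suffix: "F (suffix n u) = suffix (K * n) (F u)"
    and desubst_exists: "x \<in> L \<Longrightarrow> \<exists>u\<in>L. \<exists>p<K. x = suffix p (F u)"
    and desubst_unique: "u \<in> L \<Longrightarrow> v \<in> L \<Longrightarrow> p < K \<Longrightarrow> q < K \<Longrightarrow>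
          suffix p (F u) = suffix q (F v) \<Longrightarrow> u = v \<and> p = q"
begin

lemma F_first: "q < K \<Longrightarrow> F u q = F (\<lambda>_. u 0) q"
  by (rule F_local) simp

lemma F_prefix_cong: "(\<And>i. i < n \<Longrightarrow> u i = v i) \<Longrightarrow> i < n \<Longrightarrow> F u i = F v i"
  by (rule F_local) (meson div_le_dividend le_less_trans)

lemma piece_subset: "A \<subseteq> L \<Longrightarrow> piece F p A \<subseteq> L"
  by (auto simp: piece_def F_L L_suffix)

lemma piece_disjoint:
  assumes "A \<subseteq> L" "B \<subseteq> L" "p < K" "q < K" "x \<in> piece F p A" "x \<in> piece F q B"
  shows "p = q \<and> (\<exists>u\<in>A \<inter> B. x = suffix p (F u))"
proof -
  obtain u v where u: "u \<in> A" "x = suffix p (F u)" and v: "v \<in> B" "x = suffix q (F v)"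
    using assms(5,6) by (auto elim!: pieceE)
  hence "u = v \<and> p = q" using assms(1-4) by (intro desubst_unique) auto
  thus ?thesis using u v by blast
qed

text \<open>Compactness: a cluster point of the preimages of the approximating words lies in
  \<open>A\<close>, and by locality of \<open>F\<close> its shifted image is the limit word.\<close>

lemma piece_closed:
  assumes "cyl_closed A"
  shows "cyl_closed (piece F p A)"
proof (rule cyl_closedI)
  fix x assume "\<And>n. \<exists>y\<in>piece F p A. \<forall>i<n. x i = y i"
  hence "\<exists>u\<in>A. \<forall>i<n. x i = F u (p + i)" for n
    by (fastforce simp: piece_def)
  then obtain Y where Y: "\<And>n. Y n \<in> A" "\<And>n i. i < n \<Longrightarrow> x i = F (Y n) (p + i)"
    by metis
  obtain z where z: "\<And>n. infinite {m. \<forall>i<n. Y m i = z i}"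
    using koenig[of Y] by blast
  have "z \<in> A"
  proof (rule cyl_closedD[OF assms])
    fix n
    obtain m where "\<forall>i<n. Y m i = z i"
      using infinite_imp_nonempty[OF z[of n]] by auto
    thus "\<exists>y\<in>A. \<forall>i<n. z i = y i" using Y(1)[of m] by (intro bexI[of _ "Y m"]) auto
  qed
  moreover have "x = suffix p (F z)"
  proof
    fix i
    obtain m where m: "m > i" "\<forall>j<p + Suc i. Y m j = z j"
      using z[of "p + Suc i"] unfolding infinite_nat_iff_unbounded by auto
    have "x i = F (Y m) (p + i)" using Y(2) m by simp
    also have "\<dots> = F z (p + i)" by (rule F_prefix_cong[of "p + Suc i"]) (use m in auto)
    finally show "x i = suffix p (F z) i" by simp
  qed
  ultimately show "x \<in> piece F p A" by (rule pieceI)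
qed

lemma piece_sets: "cyl_closed A \<Longrightarrow> A \<subseteq> L \<Longrightarrow> piece F p A \<in> sets \<mu>"
  by (intro closed_sets piece_closed piece_subset)

text \<open>By uniqueness of desubstitution, a word whose shift sits at position
  \<open>p + 1\<close> of a block sits itself at position \<open>p\<close> of the same block. Hence
  one piece is the shift preimage of the next, and invariance applies.\<close>

lemma measure_piece:
  assumes "cyl_closed A" "A \<subseteq> L" "p < K"
  shows "measure \<mu> (piece F p A) = measure \<mu> (piece F 0 A)"
  using \<open>p < K\<close>
proof (induction p)
  case (Suc p)
  have "{x\<in>L. suffix 1 x \<in> piece F (Suc p) A} = piece F p A"
  proof (intro equalityI subsetI)
    fix x assume "x \<in> {x\<in>L. suffix 1 x \<in> piece F (Suc p) A}"
    then obtain u where x: "x \<in> L" and u: "u \<in> A" "suffix 1 x = suffix (Suc p) (F u)"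
      by (auto elim: pieceE)
    obtain v q where v: "v \<in> L" "q < K" "x = suffix q (F v)"
      using desubst_exists[OF x] by blast
    show "x \<in> piece F p A"
    proof (cases "Suc q < K")
      case True
      have "suffix (Suc q) (F v) = suffix (Suc p) (F u)"
        using v u by simp
      hence "v = u \<and> Suc q = Suc p"
        by (intro desubst_unique) (use True Suc.prems v u assms(2) in auto)
      thus ?thesis using v u by (auto intro: pieceI)
    next
      \<comment> \<open>Here \<open>x\<close> starts at the last letter of its block, so its shift
        starts a new block at position 0, which contradicts position \<open>Suc p\<close>.\<close>
      case False
      hence "Suc q = K" using v by simp
      hence "suffix 0 (F (suffix 1 v)) = suffix (Suc p) (F u)"
        using v(3) u(2) by (simp add: F_suffix)
      hence "suffix 1 v = u \<and> 0 = Suc p"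
        by (intro desubst_unique) (use Suc.prems v(1) u(1) assms(2) L_suffix K_pos in auto)
      thus ?thesis by simp
    qed
  next
    fix x assume "x \<in> piece F p A"
    thus "x \<in> {x\<in>L. suffix 1 x \<in> piece F (Suc p) A}"
      using piece_subset[OF assms(2)] by (auto elim!: pieceE intro: pieceI)
  qed
  thus ?case
    using measure_suffix_vimage[OF piece_sets[OF assms(1,2)], of "Suc p"] Suc by simp
qed simp

text \<open>The \<open>K\<close> pieces are disjoint and of equal measure in a probability
  space.\<close>

lemma measure_piece_le:
  assumes "cyl_closed A" "A \<subseteq> L" "p < K"
  shows "measure \<mu> (piece F p A) \<le> 1 / K"
proof -
  have "disjoint_family_on (\<lambda>p. piece F p A) {..<K}"
    unfolding disjoint_family_on_def
  proof (intro ballI impI equals0I)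
    fix p q x assume "p \<in> {..<K}" "q \<in> {..<K}" "p \<noteq> q" "x \<in> piece F p A \<inter> piece F q A"
    thus False using piece_disjoint[OF assms(2,2), of p q x] by simp
  qed
  hence "(\<Sum>p<K. measure \<mu> (piece F p A)) = measure \<mu> (\<Union>p<K. piece F p A)"
    using piece_sets[OF assms(1,2)] by (intro finite_measure_finite_Union[symmetric]) auto
  also have "\<dots> \<le> 1" by (rule prob_le_1)
  also have "(\<Sum>p<K. measure \<mu> (piece F p A)) = (\<Sum>p<K. measure \<mu> (piece F 0 A))"
    by (rule sum.cong[OF refl], rule measure_piece[OF assms(1,2)]) simp
  finally have "measure \<mu> (piece F 0 A) \<le> 1 / K"
    using K_pos by (simp add: field_simps)
  thus ?thesis unfolding measure_piece[OF assms] .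
qed

lemma funpow_suffix: "(F ^^ m) (suffix n u) = suffix (K ^ m * n) ((F ^^ m) u)"
proof (induction m)
  case (Suc m)
  thus ?case unfolding funpow.simps o_apply by (simp only: F_suffix power_Suc mult.assoc)
qed simp

text \<open>A position \<open>j\<close> in a block of level \<open>m + 1\<close> splits into
  \<open>j mod K\<close>, handled by the outermost \<open>F\<close>, and \<open>j div K\<close>, a
  position in a block of level \<open>m\<close>. Existence and uniqueness compose along this
  splitting.\<close>

lemma desubstitution_power: "desubstitution L \<mu> (K ^ m) (F ^^ m)"
proof (induction m)
  case 0
  show ?case by unfold_locales auto
next
  case (Suc m)
  interpret P: desubstitution L \<mu> "K ^ m" "F ^^ m" by (rule Suc)
  have comp: "(F ^^ Suc m) u = F ((F ^^ m) u)" for u by simp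
  show ?case
  proof unfold_locales
    show "0 < K ^ Suc m" using K_pos by simp
    show "(F ^^ Suc m) u \<in> L" if "u \<in> L" for u
      using that by (simp add: F_L P.F_L)
    show "(F ^^ Suc m) u i = (F ^^ Suc m) v i"
      if "u (i div K ^ Suc m) = v (i div K ^ Suc m)" for u v i
      unfolding comp using that by (intro F_local P.F_local) (simp add: div_mult2_eq)
    show "(F ^^ Suc m) (suffix n u) = suffix (K ^ Suc m * n) ((F ^^ Suc m) u)" for n u
      by (rule funpow_suffix)
    show "\<exists>u\<in>L. \<exists>p<K ^ Suc m. x = suffix p ((F ^^ Suc m) u)" if x: "x \<in> L" for x
    proof -
      obtain y p where y: "y \<in> L" "p < K" "x = suffix p (F y)"
        using desubst_exists[OF x] by blast
      obtain u q where u: "u \<in> L" "q < K ^ m" "y = suffix q ((F ^^ m) u)"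
        using P.desubst_exists[OF y(1)] by blast
      have "K * q + p < K * Suc q" using y by simp
      also have "\<dots> \<le> K * K ^ m" using u by (intro mult_left_mono) auto
      finally show ?thesis using u y
        by (intro bexI[of _ u] exI[of _ "K * q + p"]) (simp_all add: F_suffix)
    qed
    show "u = v \<and> p = q"
      if u: "u \<in> L" "v \<in> L" and p: "p < K ^ Suc m" "q < K ^ Suc m"
        and eq: "suffix p ((F ^^ Suc m) u) = suffix q ((F ^^ Suc m) v)" for u v p q
    proof -
      have split: "suffix j ((F ^^ Suc m) z)
          = suffix (j mod K) (F (suffix (j div K) ((F ^^ m) z)))" for j z
        by (simp add: F_suffix)
      have 1: "suffix (p div K) ((F ^^ m) u) = suffix (q div K) ((F ^^ m) v) \<and> p mod K = q mod K"
        by (intro desubst_unique L_suffix P.F_L u)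
          (use eq K_pos in \<open>simp_all only: split mod_less_divisor\<close>)
      have "p div K < K ^ m" "q div K < K ^ m"
        using p K_pos by (simp_all add: div_less_iff_less_mult mult.commute)
      hence "u = v \<and> p div K = q div K"
        using 1 by (intro P.desubst_unique u) simp_all
      thus ?thesis using 1 by (metis div_mult_mod_eq)
    qed
  qed
qed

end

subsection \<open>Positive stochastic matrices\<close>

text \<open>
  Differences of consecutive rows have zero sum, so a positive column-stochastic matrix contracts
  them in the \<open>\<ell>\<^sup>1\<close> norm; since every row is obtained from rows arbitrarily far away, the
  differences vanish.
\<close>

lemma stationary_of_positive_stochastic:
  fixes y :: "nat \<Rightarrow> 'a::finite \<Rightarrow> real" and N :: "'a \<Rightarrow> 'a \<Rightarrow> real"
  assumes c: "c > 0" "\<And>a b. N a b \<ge> c"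
    and N_sum: "\<And>b. (\<Sum>a\<in>UNIV. N a b) = 1"
    and rec: "\<And>m a. y m a = (\<Sum>b\<in>UNIV. N a b * y (m + n) b)"
    and y_sum: "\<And>m. (\<Sum>a\<in>UNIV. y m a) = 1"
    and y_nonneg: "\<And>m a. y m a \<ge> 0"
  shows "y (Suc m) a = y m a"
proof -
  define d where "d m = (\<Sum>a\<in>UNIV. \<bar>y (Suc m) a - y m a\<bar>)" for m
  \<comment> \<open>The column sum left after subtracting \<open>c\<close> from every entry of
    \<open>N\<close>. Subtracting the constant does not change the action on vectors of zero sum, so
    this is the contraction factor.\<close>
  define \<rho> where "\<rho> = 1 - CARD('a) * c"
  have \<rho>_sum: "(\<Sum>a\<in>UNIV. N a b - c) = \<rho>" for b
    by (simp add: sum_subtractf N_sum \<rho>_def)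
  have \<rho>: "0 \<le> \<rho>" "\<rho> < 1"
    using \<rho>_sum[of undefined] sum_nonneg[of UNIV "\<lambda>a. N a undefined - c"] c
    by (auto simp: \<rho>_def)
  have d_le: "d m \<le> 2" for m
  proof -
    have "d m \<le> (\<Sum>a\<in>UNIV. y (Suc m) a + y m a)"
      unfolding d_def by (intro sum_mono) (metis abs_of_nonneg abs_triangle_ineq4 y_nonneg)
    thus ?thesis by (simp add: sum.distrib y_sum)
  qed
  have step: "d m \<le> \<rho> * d (m + n)" for m
  proof -
    let ?z = "\<lambda>b. y (Suc m + n) b - y (m + n) b"
    have z: "y (Suc m) a - y m a = (\<Sum>b\<in>UNIV. (N a b - c) * ?z b)" for a
    proof -
      have "y (Suc m) a - y m a = (\<Sum>b\<in>UNIV. N a b * ?z b)"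
        unfolding rec[of m] rec[of "Suc m"] by (simp add: sum_subtractf algebra_simps)
      moreover have "(\<Sum>b\<in>UNIV. c * ?z b) = 0"
        unfolding sum_distrib_left[symmetric] by (simp only: sum_subtractf y_sum) simp
      ultimately show ?thesis by (simp add: left_diff_distrib sum_subtractf)
    qed
    have "d m \<le> (\<Sum>a\<in>UNIV. \<Sum>b\<in>UNIV. (N a b - c) * \<bar>?z b\<bar>)"
      unfolding d_def z
    proof (intro sum_mono order.trans[OF sum_abs])
      fix a b show "\<bar>(N a b - c) * ?z b\<bar> \<le> (N a b - c) * \<bar>?z b\<bar>"
        using c(2)[of a b] by (simp add: abs_mult)
    qed
    also have "\<dots> = (\<Sum>b\<in>UNIV. (\<Sum>a\<in>UNIV. N a b - c) * \<bar>?z b\<bar>)"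
      by (subst sum.swap) (simp add: sum_distrib_right)
    also have "\<dots> = \<rho> * d (m + n)"
      by (simp only: \<rho>_sum d_def sum_distrib_left[symmetric] add_Suc)
    finally show ?thesis .
  qed
  have "d m \<le> \<rho> ^ j * 2" for j
  proof -
    have "d m \<le> \<rho> ^ j * d (m + j * n)" for m
    proof (induction j arbitrary: m)
      case (Suc j)
      have "d m \<le> \<rho> * d (m + n)" by (rule step)
      also have "\<dots> \<le> \<rho> * (\<rho> ^ j * d (m + n + j * n))"
        using \<rho> Suc by (intro mult_left_mono) auto
      finally show ?case by (simp add: algebra_simps)
    qed simp
    also have "\<rho> ^ j * d (m + j * n) \<le> \<rho> ^ j * 2" using \<rho> d_le by (intro mult_left_mono) auto
    finally show ?thesis .
  qed
  moreover have "(\<lambda>j. \<rho> ^ j * 2) \<longlonglongrightarrow> 0"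
    using \<rho> by (intro tendsto_mult_left_zero LIMSEQ_realpow_zero) auto
  ultimately have "d m \<le> 0" by (intro LIMSEQ_le_const[of "\<lambda>j. \<rho> ^ j * 2"]) auto
  hence "d m = 0" unfolding d_def by (intro antisym sum_nonneg) auto
  thus ?thesis by (simp add: d_def sum_nonneg_eq_0_iff)
qed

subsection \<open>Measures of pieces\<close>

context desubstitution
begin

abbreviation cylinder :: "'a \<Rightarrow> 'a word set" where
  "cylinder a \<equiv> {x\<in>L. x 0 = a}"

lemma cyl_closed_cylinder: "cyl_closed {x\<in>L. P (x 0)}"
  using cyl_closed_Int[OF L_closed cyl_closed_first[of P]]
  by (simp add: Int_def)

text \<open>Pieces with distinct pairs of letter and position are disjoint by unique desubstitution,
  and the measure of each depends only on its letter.\<close>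

lemma measure_Union_pieces:
  assumes "finite I" "\<And>i. i \<in> I \<Longrightarrow> q i < K" "inj_on (\<lambda>i. (b i, q i)) I"
  shows "measure \<mu> (\<Union>i\<in>I. piece F (q i) (cylinder (b i)))
       = (\<Sum>i\<in>I. measure \<mu> (piece F 0 (cylinder (b i))))"
proof -
  have "disjoint_family_on (\<lambda>i. piece F (q i) (cylinder (b i))) I"
    unfolding disjoint_family_on_def
  proof (intro ballI impI equals0I)
    fix i j x
    assume ij: "i \<in> I" "j \<in> I" "i \<noteq> j"
      and x: "x \<in> piece F (q i) (cylinder (b i)) \<inter> piece F (q j) (cylinder (b j))"
    have "q i = q j \<and> (\<exists>u\<in>cylinder (b i) \<inter> cylinder (b j). x = suffix (q i) (F u))"
      by (rule piece_disjoint) (use ij x assms(2) in auto)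
    hence "(b i, q i) = (b j, q j)" by auto
    thus False using inj_onD[OF assms(3)] ij by blast
  qed
  hence "measure \<mu> (\<Union>i\<in>I. piece F (q i) (cylinder (b i)))
       = (\<Sum>i\<in>I. measure \<mu> (piece F (q i) (cylinder (b i))))"
    using assms(1) by (intro finite_measure_finite_Union)
      (auto intro!: piece_sets cyl_closed_cylinder)
  also have "\<dots> = (\<Sum>i\<in>I. measure \<mu> (piece F 0 (cylinder (b i))))"
    by (intro sum.cong measure_piece cyl_closed_cylinder) (use assms(2) in auto)
  finally show ?thesis .
qed

lemma piece_funpow_add:
  "piece (F ^^ m) p (piece (F ^^ n) q A) = piece (F ^^ (m + n)) (K ^ m * q + p) A"
  unfolding piece_def image_image funpow_add o_apply by (simp add: funpow_suffix)

section \<open>The incidence matrix and the measures of pieces of level \<open>m\<close>\<close>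

definition base_measure :: "nat \<Rightarrow> 'a \<Rightarrow> real" where
  "base_measure m a = measure \<mu> (piece (F ^^ m) 0 (cylinder a))"

text \<open>The constant word stands in for the letter \<open>b\<close>: the first
  \<open>K ^ n\<close> letters of its image form the block of \<open>b\<close>. The cardinalities
  are the entries of the incidence matrix of the \<open>n\<close>-th power.\<close>

definition occurrences :: "nat \<Rightarrow> 'a \<Rightarrow> 'a \<Rightarrow> nat set" where
  "occurrences n a b = {q. q < K ^ n \<and> (F ^^ n) (\<lambda>_. b) q = a}"

lemma finite_occurrences: "finite (occurrences n a b)"
  by (simp add: occurrences_def)

lemma sum_card_occurrences: "(\<Sum>a\<in>UNIV. card (occurrences n a b)) = K ^ n"
proof -
  have "(\<Sum>a\<in>UNIV. card (occurrences n a b)) = card (\<Union>a. occurrences n a b)"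
    by (rule card_UN_disjoint[symmetric]) (auto simp: occurrences_def)
  also have "(\<Union>a. occurrences n a b) = {..<K ^ n}" by (auto simp: occurrences_def)
  finally show ?thesis by simp
qed

text \<open>Desubstituting \<open>n\<close> times cuts the cylinder of \<open>a\<close> into pieces
  of level \<open>n\<close>, one for each occurrence of \<open>a\<close> in the block of some letter
  \<open>b\<close>. Applying \<open>F ^^ m\<close> makes them disjoint pieces of level
  \<open>m + n\<close>.\<close>

lemma base_measure_rec:
  "base_measure m a = (\<Sum>b\<in>UNIV. card (occurrences n a b) * base_measure (m + n) b)"
proof -
  interpret Q: desubstitution L \<mu> "K ^ n" "F ^^ n" by (rule desubstitution_power)
  interpret R: desubstitution L \<mu> "K ^ (m + n)" "F ^^ (m + n)" by (rule desubstitution_power)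
  let ?S = "SIGMA b:UNIV. occurrences n a b"
  have "cylinder a = (\<Union>t\<in>?S. piece (F ^^ n) (snd t) (cylinder (fst t)))"
  proof (intro equalityI subsetI)
    fix x assume x: "x \<in> cylinder a"
    then obtain u q where u: "u \<in> L" "q < K ^ n" "x = suffix q ((F ^^ n) u)"
      using Q.desubst_exists by blast
    hence "(u 0, q) \<in> ?S" using x Q.F_first[of q u] by (auto simp: occurrences_def)
    moreover have "x \<in> piece (F ^^ n) q (cylinder (u 0))"
      by (rule pieceI[of u]) (use u in auto)
    ultimately show "x \<in> (\<Union>t\<in>?S. piece (F ^^ n) (snd t) (cylinder (fst t)))"
      by (intro UN_I[of "(u 0, q)"]) auto
  next
    fix x assume "x \<in> (\<Union>t\<in>?S. piece (F ^^ n) (snd t) (cylinder (fst t)))"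
    then obtain b q u where "q < K ^ n" "(F ^^ n) (\<lambda>_. b) q = a" "u \<in> L" "u 0 = b"
      "x = suffix q ((F ^^ n) u)"
      by (auto simp: occurrences_def elim!: pieceE)
    thus "x \<in> cylinder a" using Q.F_first[of q u] by (simp add: L_suffix Q.F_L)
  qed
  hence "piece (F ^^ m) 0 (cylinder a)
      = (\<Union>t\<in>?S. piece (F ^^ m) 0 (piece (F ^^ n) (snd t) (cylinder (fst t))))"
    unfolding piece_def by blast
  also have "\<dots> = (\<Union>t\<in>?S. piece (F ^^ (m + n)) (K ^ m * snd t) (cylinder (fst t)))"
    unfolding piece_funpow_add by simp
  also have "measure \<mu> \<dots> = (\<Sum>t\<in>?S. base_measure (m + n) (fst t))"
    unfolding base_measure_def
  proof (rule R.measure_Union_pieces)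
    show "finite ?S" by (intro finite_SigmaI finite_occurrences finite)
    show "K ^ m * snd t < K ^ (m + n)" if "t \<in> ?S" for t
      using that K_pos by (auto simp: occurrences_def power_add)
    show "inj_on (\<lambda>t. (fst t, K ^ m * snd t)) ?S"
      using K_pos by (auto simp: inj_on_def)
  qed
  also have "\<dots> = (\<Sum>b\<in>UNIV. \<Sum>q\<in>occurrences n a b. base_measure (m + n) b)"
    by (subst sum.Sigma) (auto simp: finite_occurrences split_def)
  finally show ?thesis by (simp add: base_measure_def)
qed

text \<open>The pieces of level 0 are the cylinders, which partition \<open>L\<close>. Passing from
  level 0 to level \<open>m\<close> brings in the column sums \<open>K ^ m\<close> of the incidence
  matrix.\<close>

lemma sum_base_measure: "K ^ m * (\<Sum>a\<in>UNIV. base_measure m a) = 1"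
proof -
  interpret I: desubstitution L \<mu> "K ^ 0" "F ^^ 0" by (rule desubstitution_power)
  have "(\<Union>a\<in>UNIV. piece (F ^^ 0) 0 (cylinder a)) = space \<mu>"
    by (auto simp: space_\<mu> piece_def)
  hence "1 = measure \<mu> (\<Union>a\<in>UNIV. piece (F ^^ 0) 0 (cylinder a))"
    by (simp only: prob_space)
  also have "\<dots> = (\<Sum>a\<in>UNIV. base_measure 0 a)"
    unfolding base_measure_def by (rule I.measure_Union_pieces) (auto simp: inj_on_def)
  also have "\<dots> = (\<Sum>a\<in>UNIV. \<Sum>b\<in>UNIV. card (occurrences m a b) * base_measure m b)"
    using base_measure_rec[of 0 _ m] by simp
  also have "\<dots> = (\<Sum>b\<in>UNIV. real (\<Sum>a\<in>UNIV. card (occurrences m a b)) * base_measure m b)"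
    by (subst sum.swap) (simp add: sum_distrib_right)
  finally show ?thesis by (simp add: sum_card_occurrences sum_distrib_left)
qed

text \<open>After scaling by \<open>K ^ m\<close> the vectors are probability vectors linked by the
  incidence matrix divided by \<open>K ^ n\<close>. By primitivity each count is at least 1, so the
  entries are at least \<open>1 / K ^ n\<close> and the vectors are constant in
  \<open>m\<close>.\<close>

lemma base_measure_Suc:
  assumes primitive: "\<And>a b. \<exists>q<K ^ n. (F ^^ n) (\<lambda>_. b) q = a"
  shows "base_measure (Suc m) a = base_measure m a / K"
proof -
  have "real (K ^ Suc m) * base_measure (Suc m) a = real (K ^ m) * base_measure m a"
  proof (rule stationary_of_positive_stochastic[where c = "1 / real (K ^ n)" and n = n
        and N = "\<lambda>a b. card (occurrences n a b) / real (K ^ n)"])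
    show "1 / real (K ^ n) > 0" using K_pos by simp
    show "1 / real (K ^ n) \<le> card (occurrences n a b) / real (K ^ n)" for a b
    proof -
      have "occurrences n a b \<noteq> {}" using primitive by (auto simp: occurrences_def)
      hence "card (occurrences n a b) > 0" by (simp add: card_gt_0_iff finite_occurrences)
      thus ?thesis by (intro divide_right_mono) auto
    qed
    show "(\<Sum>a\<in>UNIV. card (occurrences n a b) / real (K ^ n)) = 1" for b
      using K_pos by (simp add: sum_divide_distrib[symmetric] sum_card_occurrences
          flip: of_nat_sum)
    show "real (K ^ m) * base_measure m a = (\<Sum>b\<in>UNIV. card (occurrences n a b) / real (K ^ n)
        * (real (K ^ (m + n)) * base_measure (m + n) b))" for m a
      unfolding base_measure_rec[of m a n] using K_pos
      by (simp add: sum_distrib_left power_add field_simps)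
    show "(\<Sum>a\<in>UNIV. real (K ^ m) * base_measure m a) = 1" for m
      using sum_base_measure[of m] by (simp add: sum_distrib_left)
    show "0 \<le> real (K ^ m) * base_measure m a" for m a
      by (simp add: base_measure_def)
  qed
  thus ?thesis using K_pos by (simp add: field_simps)
qed

end

subsection \<open>Order and initial segments\<close>

text \<open>Separability enters through a fixed order \<open>r\<close> on pairs of first letter and
  position, applied directly to shifted images, so that the definite description in
  \<open>word_type\<close> is avoided.\<close>

locale ordered_desubstitution = desubstitution L \<mu> K F
  for L :: "'a::{finite, linorder} word set" and \<mu> :: "'a word measure"
    and K :: nat and F :: "'a word \<Rightarrow> 'a word" +
  fixes r :: "(('a \<times> nat) \<times> ('a \<times> nat)) set"
  assumes K_ge_2: "K \<ge> 2"
    and primitive: "\<exists>n. \<forall>a b. \<exists>q<K ^ n. (F ^^ n) (\<lambda>_. b) q = a"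
    and F_less: "u \<in> L \<Longrightarrow> v \<in> L \<Longrightarrow> less_fun (F u) (F v) \<longleftrightarrow> less_fun u v"
    and r_order: "strict_linear_order_on (UNIV \<times> {..<K}) r"
    and r_less: "u \<in> L \<Longrightarrow> v \<in> L \<Longrightarrow> p < K \<Longrightarrow> q < K \<Longrightarrow> ((u 0, p), (v 0, q)) \<in> r \<Longrightarrow>
          less_fun (suffix p (F u)) (suffix q (F v))"
begin

lemma r_irrefl: "(t, t) \<notin> r"
  using r_order unfolding strict_linear_order_on_def irrefl_def by blast

lemma r_total:
  assumes "p < K" "q < K"
  shows "(a, p) = (b, q) \<or> ((a, p), (b, q)) \<in> r \<or> ((b, q), (a, p)) \<in> r"
  using r_order assms unfolding strict_linear_order_on_def total_on_def by blast

text \<open>Equal first letters give images with the same first block, so erasing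
  \<open>p < K\<close> letters leaves the comparison unchanged.\<close>

lemma less_suffix_F:
  assumes "u \<in> L" "v \<in> L" "p < K" "u 0 = v 0"
  shows "less_fun (suffix p (F u)) (suffix p (F v)) \<longleftrightarrow> less_fun u v"
proof -
  have "F u i = F v i" if "i < p" for i
    using F_first[of i u] F_first[of i v] that assms by simp
  thus ?thesis using less_fun_same_prefix[of p "F u" "F v"] F_less assms by simp
qed

text \<open>Convexity of the pieces of level \<open>m\<close>: a point of another piece has the
  whole piece on one side. The outermost \<open>F\<close> is peeled off inductively. If the types at
  that level differ, \<open>r\<close> decides, in the same way for \<open>z\<close> and
  \<open>z'\<close>; if they agree, \<open>F\<close> cancels.\<close>

lemma less_iff_of_same_piece:
  assumes "z \<in> L" "z' \<in> L" "v \<in> L" "z 0 = z' 0" "q < K ^ m" "s < K ^ m" "(z 0, q) \<noteq> (v 0, s)"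
  shows "less_fun (suffix q ((F ^^ m) z)) (suffix s ((F ^^ m) v))
     \<longleftrightarrow> less_fun (suffix q ((F ^^ m) z')) (suffix s ((F ^^ m) v))"
  using assms(5-)
proof (induction m arbitrary: q s)
  case 0
  hence "z 0 \<noteq> v 0" by simp
  hence "less_fun y v \<longleftrightarrow> y 0 < v 0" if "y 0 = z 0" for y
    using that unfolding less_fun_def by (metis gr_zeroI less_nat_zero_code)
  thus ?case using 0 assms by simp
next
  case (Suc m)
  interpret P: desubstitution L \<mu> "K ^ m" "F ^^ m" by (rule desubstitution_power)
  let ?x = "suffix (q div K) ((F ^^ m) z)" and ?x' = "suffix (q div K) ((F ^^ m) z')"
    and ?u = "suffix (s div K) ((F ^^ m) v)"
  have split: "suffix j ((F ^^ Suc m) y) = suffix (j mod K) (F (suffix (j div K) ((F ^^ m) y)))"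
    for j y by (simp add: F_suffix)
  have L: "?x \<in> L" "?x' \<in> L" "?u \<in> L" using assms by (auto intro: L_suffix P.F_L)
  have div: "q div K < K ^ m" "s div K < K ^ m"
    using Suc.prems K_pos by (simp_all add: div_less_iff_less_mult mult.commute)
  have mod: "q mod K < K" "s mod K < K" using K_pos by simp_all
  have x0: "?x' 0 = ?x 0"
    using P.F_first[OF div(1), of z] P.F_first[OF div(1), of z'] assms(4) by simp
  show ?case
  proof (cases "(?x 0, q mod K) = (?u 0, s mod K)")
    case True
    \<comment> \<open>The remainders agree in this case, so the two pieces of the lower level must
      still differ.\<close>
    have "(z 0, q div K) \<noteq> (v 0, s div K)"
      using True Suc.prems(3) by (metis Pair_inject div_mult_mod_eq)
    from Suc.IH[OF div this] show ?thesis
      unfolding split using True x0 L mod by (simp only: less_suffix_F prod.inject)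
  next
    case False
    then consider "((?x 0, q mod K), (?u 0, s mod K)) \<in> r" | "((?u 0, s mod K), (?x 0, q mod K)) \<in> r"
      using r_total[OF mod] by blast
    thus ?thesis
    proof cases
      case 1
      thus ?thesis unfolding split
        using r_less[OF L(1,3) mod] r_less[OF L(2,3) mod] unfolding x0 by blast
    next
      case 2
      thus ?thesis unfolding split
        using r_less[OF L(3,1) mod(2,1)] r_less[OF L(3,2) mod(2,1)] less_fun_asym
        unfolding x0 by metis
    qed
  qed
qed

section \<open>Scaling of initial segments and the recurrence for \<open>nu\<close>\<close>

abbreviation below :: "'a word \<Rightarrow> 'a word set" where
  "below v \<equiv> {x\<in>L. x = v \<or> less_fun x v}"

lemma cyl_closed_below: "cyl_closed (below v)"
  using cyl_closed_Int[OF L_closed cyl_closed_atMost[of v]] by (simp add: Int_def)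

lemma piece_piece: "piece F p (piece (F ^^ m) q A) = piece (F ^^ Suc m) (K * q + p) A"
  using piece_funpow_add[of 1 p m q A] by simp

text \<open>
  Up to a single piece of level \<open>m\<close>, which has measure at most \<open>1 / K ^ m\<close>, an initial segment of
  \<open>L\<close> is a union of pieces of level \<open>m\<close>, whose measures scale exactly.
\<close>

lemma measure_piece_below_approx:
  assumes v: "v \<in> L" and p: "p < K"
  shows "\<bar>measure \<mu> (piece F p (below v)) - measure \<mu> (below v) / K\<bar> \<le> (1 / K) ^ m"
proof -
  interpret P: desubstitution L \<mu> "K ^ m" "F ^^ m" by (rule desubstitution_power)
  interpret R: desubstitution L \<mu> "K ^ Suc m" "F ^^ Suc m" by (rule desubstitution_power)
  obtain n where n: "\<And>a b. \<exists>q<K ^ n. (F ^^ n) (\<lambda>_. b) q = a" using primitive by blast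
  obtain u s where u: "u \<in> L" "s < K ^ m" "v = suffix s ((F ^^ m) u)"
    using P.desubst_exists[OF v] by blast
  define E where "E t = piece (F ^^ m) (snd t) (cylinder (fst t))" for t
  \<comment> \<open>The piece with index \<open>(u 0, s)\<close> contains \<open>v\<close> and may
    lie only partly below it, so it is kept apart as the error term.\<close>
  define S where "S = {t\<in>UNIV \<times> {..<K ^ m}. t \<noteq> (u 0, s) \<and> E t \<subseteq> below v}"
  have S_fin: "finite S" unfolding S_def by (intro finite_Collect_conjI disjI1) simp
  have S_q: "snd t < K ^ m" if "t \<in> S" for t using that by (auto simp: S_def)
  have E_L: "E t \<subseteq> L" for t unfolding E_def by (intro P.piece_subset) auto
  have E_closed: "cyl_closed (E t)" for t
    unfolding E_def by (intro P.piece_closed cyl_closed_cylinder)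
  have lower: "\<Union>(E ` S) \<subseteq> below v" by (auto simp: S_def)
  have upper: "below v \<subseteq> \<Union>(E ` S) \<union> E (u 0, s)"
  proof
    fix x assume x: "x \<in> below v"
    then obtain z q where z: "z \<in> L" "q < K ^ m" "x = suffix q ((F ^^ m) z)"
      using P.desubst_exists by blast
    have xE: "x \<in> E (z 0, q)" unfolding E_def by (rule pieceI[of z]) (use z in auto)
    show "x \<in> \<Union>(E ` S) \<union> E (u 0, s)"
    proof (cases "(z 0, q) = (u 0, s)")
      case False
      have "x \<noteq> v"
      proof
        assume "x = v"
        hence "z = u \<and> q = s" using z u by (intro P.desubst_unique) auto
        thus False using False by simp
      qed
      hence less: "less_fun x v" using x by simp
      \<comment> \<open>Convexity: \<open>x\<close> lies below \<open>v\<close> and in a piece other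
        than that of \<open>v\<close>, so its whole piece lies below \<open>v\<close>.\<close>
      have "E (z 0, q) \<subseteq> below v"
      proof
        fix y assume y: "y \<in> E (z 0, q)"
        then obtain z' where z': "z' \<in> L" "z' 0 = z 0" "y = suffix q ((F ^^ m) z')"
          unfolding E_def by (auto elim: pieceE)
        have "less_fun y v"
          using less less_iff_of_same_piece[of z z' u q m s] z z' u False by simp
        thus "y \<in> below v" using y E_L by auto
      qed
      hence "(z 0, q) \<in> S" using z False by (simp add: S_def)
      thus ?thesis using xE by blast
    qed (use xE in simp)
  qed
  have E_small: "measure \<mu> (E t) \<le> 1 / K ^ m" if "snd t < K ^ m" for t
    unfolding E_def using P.measure_piece_le[OF cyl_closed_cylinder _ that] by simp
  have FE: "piece F p (E t) = piece (F ^^ Suc m) (K * snd t + p) (cylinder (fst t))" for t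
    unfolding E_def piece_piece ..
  have lt: "K * q + p < K ^ Suc m" if "q < K ^ m" for q
  proof -
    have "K * q + p < K * Suc q" using p by simp
    also have "\<dots> \<le> K * K ^ m" using that by (intro mult_left_mono) auto
    finally show ?thesis by simp
  qed
  have E_sum: "measure \<mu> (\<Union>(E ` S)) = (\<Sum>t\<in>S. base_measure m (fst t))"
    unfolding E_def base_measure_def
    by (rule P.measure_Union_pieces) (auto simp: S_fin S_q)
  have FE_sum: "measure \<mu> (piece F p (\<Union>(E ` S))) = measure \<mu> (\<Union>(E ` S)) / K"
  proof -
    have "piece F p (\<Union>(E ` S)) = (\<Union>t\<in>S. piece F p (E t))" unfolding piece_def by blast
    also have "measure \<mu> \<dots> = (\<Sum>t\<in>S. base_measure (Suc m) (fst t))"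
      unfolding FE base_measure_def
    proof (rule R.measure_Union_pieces[OF S_fin])
      show "K * snd t + p < K ^ Suc m" if "t \<in> S" for t using lt S_q[OF that] .
      show "inj_on (\<lambda>t. (fst t, K * snd t + p)) S"
        using K_pos by (auto simp: inj_on_def)
    qed
    finally show ?thesis
      unfolding E_sum by (simp add: base_measure_Suc[OF n] sum_divide_distrib)
  qed
  have E_sets: "E t \<in> sets \<mu>" "piece F p (E t) \<in> sets \<mu>" for t
    by (intro closed_sets piece_sets E_closed E_L)+
  have sets: "\<Union>(E ` S) \<in> sets \<mu>" "below v \<in> sets \<mu>" "piece F p (below v) \<in> sets \<mu>"
    "piece F p (\<Union>(E ` S)) \<in> sets \<mu>"
  proof -
    show "\<Union>(E ` S) \<in> sets \<mu>" using S_fin E_sets by auto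
    show "below v \<in> sets \<mu>" "piece F p (below v) \<in> sets \<mu>"
      using cyl_closed_below by (auto intro!: closed_sets piece_sets)
    have "piece F p (\<Union>(E ` S)) = (\<Union>t\<in>S. piece F p (E t))" unfolding piece_def by blast
    thus "piece F p (\<Union>(E ` S)) \<in> sets \<mu>" using S_fin E_sets by auto
  qed
  have "measure \<mu> (piece F p (E (u 0, s))) = base_measure (Suc m) (u 0)"
    unfolding FE base_measure_def using lt[OF u(2)]
    by (simp only: fst_conv snd_conv) (intro R.measure_piece cyl_closed_cylinder; auto)
  also have "\<dots> = measure \<mu> (E (u 0, s)) / K"
  proof -
    have "measure \<mu> (E (u 0, s)) = base_measure m (u 0)"
      unfolding E_def base_measure_def fst_conv snd_conv
      by (rule P.measure_piece[OF cyl_closed_cylinder _ u(2)]) auto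
    thus ?thesis by (simp only: base_measure_Suc[OF n])
  qed
  finally have FE_u: "measure \<mu> (piece F p (E (u 0, s))) = measure \<mu> (E (u 0, s)) / K" .
  \<comment> \<open>Both quantities to be compared lie between \<open>M / K\<close> and
    \<open>(M + e) / K\<close>, so they differ by at most \<open>e / K\<close>.\<close>
  define M e where "M = measure \<mu> (\<Union>(E ` S))" and "e = measure \<mu> (E (u 0, s))"
  have e: "0 \<le> e" "e \<le> (1 / K) ^ m"
    using E_small[of "(u 0, s)"] u(2) by (simp_all add: e_def power_one_over)
  have "M \<le> measure \<mu> (below v)"
    unfolding M_def by (intro finite_measure_mono lower sets)
  moreover have "measure \<mu> (below v) \<le> M + e"
    unfolding M_def e_def
    by (rule order.trans[OF finite_measure_mono[OF upper] measure_Un_le])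
      (use sets E_sets in auto)
  moreover have "M / K \<le> measure \<mu> (piece F p (below v))"
    unfolding M_def FE_sum[symmetric]
    by (intro finite_measure_mono sets) (use lower in \<open>auto simp: piece_def\<close>)
  moreover have "measure \<mu> (piece F p (below v)) \<le> M / K + e / K"
  proof -
    have "piece F p (below v) \<subseteq> piece F p (\<Union>(E ` S)) \<union> piece F p (E (u 0, s))"
      unfolding piece_def image_Un[symmetric] by (rule image_mono[OF upper])
    thus ?thesis
      unfolding M_def e_def FE_sum[symmetric] FE_u[symmetric]
      by (rule order.trans[OF finite_measure_mono measure_Un_le])
        (use sets E_sets in auto)
  qed
  ultimately have "\<bar>measure \<mu> (piece F p (below v)) - measure \<mu> (below v) / K\<bar> \<le> e / K"
    using K_pos by (auto simp: abs_le_iff field_simps)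
  also have "\<dots> \<le> e" using e K_pos by (simp add: field_simps mult_le_cancel_left1)
  finally show ?thesis using e by simp
qed

text \<open>The approximation holds at every level, and its error tends to 0 because
  \<open>K\<close> is at least 2.\<close>

lemma measure_piece_below:
  assumes "v \<in> L" "p < K"
  shows "measure \<mu> (piece F p (below v)) = measure \<mu> (below v) / K"
proof -
  have "(\<lambda>m. (1 / real K) ^ m) \<longlonglongrightarrow> 0"
    using K_ge_2 by (intro LIMSEQ_realpow_zero) auto
  hence "\<bar>measure \<mu> (piece F p (below v)) - measure \<mu> (below v) / K\<bar> \<le> 0"
    using measure_piece_below_approx[OF assms] by (intro LIMSEQ_le_const) auto
  thus ?thesis by simp
qed

text \<open>The correction in the recurrence. Pieces at position \<open>p\<close> are ordered by
  \<open>r\<close> and not by their first letters, so the words with a smaller first letter are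
  removed from the image of the initial segment and left to the first term to count.\<close>

definition offset :: "'a \<Rightarrow> nat \<Rightarrow> real" where
  "offset a p =
     measure \<mu> (\<Union>t\<in>{t\<in>UNIV \<times> {..<K}. (t, (a, p)) \<in> r}. piece F (snd t) (cylinder (fst t)))
     - measure \<mu> (piece F p {x\<in>L. x 0 < a})"

text \<open>Words of a type other than \<open>(v 0, p)\<close> are placed by \<open>r\<close>, whole
  pieces at a time; words of that type compare as their preimages do. This splits the initial
  segment into two disjoint parts of known measure.\<close>

lemma measure_below_suffix_F:
  assumes v: "v \<in> L" and p: "p < K"
  shows "measure \<mu> (below (suffix p (F v))) = measure \<mu> (below v) / K + offset (v 0) p"
proof -
  let ?I = "{t\<in>UNIV \<times> {..<K}. (t, (v 0, p)) \<in> r}"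
  let ?T = "\<Union>t\<in>?I. piece F (snd t) (cylinder (fst t))"
  let ?B = "{x\<in>L. x 0 < v 0}"
  have B: "?B \<subseteq> below v" by (auto simp: less_fun_def)
  have T: "\<exists>u\<in>L. \<exists>q<K. y = suffix q (F u) \<and> ((u 0, q), (v 0, p)) \<in> r" if "y \<in> ?T" for y
    using that by (auto elim!: pieceE)
  have split: "below (suffix p (F v)) = ?T \<union> (piece F p (below v) - piece F p ?B)"
  proof (intro equalityI subsetI)
    fix y assume y: "y \<in> below (suffix p (F v))"
    then obtain u q where u: "u \<in> L" "q < K" "y = suffix q (F u)"
      using desubst_exists by blast
    consider "((u 0, q), (v 0, p)) \<in> r" | "((v 0, p), (u 0, q)) \<in> r" | "u 0 = v 0" "q = p"
      using r_total[OF u(2) p] by blast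
    thus "y \<in> ?T \<union> (piece F p (below v) - piece F p ?B)"
    proof cases
      case 1
      moreover have "y \<in> piece F q (cylinder (u 0))" by (rule pieceI[of u]) (use u in auto)
      ultimately have "y \<in> ?T" using u by (intro UN_I[of "(u 0, q)"]) auto
      thus ?thesis by blast
    next
      case 2
      hence "less_fun (suffix p (F v)) y" using r_less[OF v u(1) p u(2)] u by simp
      thus ?thesis using y less_fun_asym less_fun_irrefl by auto
    next
      case 3
      have "u = v \<or> less_fun u v"
      proof (cases "y = suffix p (F v)")
        case True
        hence "u = v \<and> q = p" using u v p by (intro desubst_unique) auto
        thus ?thesis by simp
      next
        case False
        hence "less_fun y (suffix p (F v))" using y by simp
        thus ?thesis using less_suffix_F[OF u(1) v p 3(1)] u 3 by simp
      qed
      hence "y \<in> piece F p (below v)" by (intro pieceI[of u]) (use u 3 in auto)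
      moreover have "y \<notin> piece F p ?B"
      proof
        assume "y \<in> piece F p ?B"
        then obtain z where z: "z \<in> L" "z 0 < v 0" "y = suffix p (F z)" by (auto elim!: pieceE)
        hence "z = u \<and> p = q" using u p by (intro desubst_unique) auto
        thus False using z 3 by simp
      qed
      ultimately show ?thesis by blast
    qed
  next
    fix y assume "y \<in> ?T \<union> (piece F p (below v) - piece F p ?B)"
    then consider "y \<in> ?T" | "y \<in> piece F p (below v)" "y \<notin> piece F p ?B" by blast
    thus "y \<in> below (suffix p (F v))"
    proof cases
      case 1
      then obtain u q where "u \<in> L" "q < K" "y = suffix q (F u)" "((u 0, q), (v 0, p)) \<in> r"
        using T by blast
      thus ?thesis using r_less[OF _ v _ p] by (auto intro: L_suffix F_L)
    next
      case 2
      then obtain u where u: "u \<in> L" "u = v \<or> less_fun u v" "y = suffix p (F u)"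
        by (auto elim!: pieceE)
      have "\<not> u 0 < v 0" using 2(2) u by (auto intro: pieceI)
      hence "u 0 = v 0" using u(2) unfolding less_fun_def by (metis gr_zeroI)
      thus ?thesis using u less_suffix_F[OF u(1) v p] by (auto intro: L_suffix F_L)
    qed
  qed
  have disj: "?T \<inter> (piece F p (below v) - piece F p ?B) = {}"
  proof (rule equals0I)
    fix y assume y: "y \<in> ?T \<inter> (piece F p (below v) - piece F p ?B)"
    then obtain u q where u: "u \<in> L" "q < K" "y = suffix q (F u)" "((u 0, q), (v 0, p)) \<in> r"
      using T by blast
    obtain z where z: "z \<in> L" "z = v \<or> less_fun z v" "y = suffix p (F z)"
      using y by (auto elim!: pieceE)
    have "\<not> z 0 < v 0" using y z by (auto intro: pieceI)
    hence "z 0 = v 0" using z(2) unfolding less_fun_def by (metis gr_zeroI)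
    moreover have "u = z \<and> q = p" using u z p by (intro desubst_unique) auto
    ultimately show False using u r_irrefl by simp
  qed
  have "finite ?I" by (intro finite_Collect_conjI disjI1) simp
  hence T_sets: "?T \<in> sets \<mu>" by (intro sets.finite_UN piece_sets cyl_closed_cylinder) auto
  have B_sets: "piece F p ?B \<in> sets \<mu>" by (intro piece_sets cyl_closed_cylinder) auto
  have A_sets: "piece F p (below v) \<in> sets \<mu>" by (intro piece_sets cyl_closed_below) auto
  have "measure \<mu> (below (suffix p (F v)))
      = measure \<mu> ?T + measure \<mu> (piece F p (below v) - piece F p ?B)"
    unfolding split using T_sets A_sets B_sets disj by (intro finite_measure_Union) auto
  also have "measure \<mu> (piece F p (below v) - piece F p ?B)
      = measure \<mu> (piece F p (below v)) - measure \<mu> (piece F p ?B)"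
    using A_sets B_sets B by (intro finite_measure_Diff) (auto simp: piece_def)
  finally show ?thesis unfolding measure_piece_below[OF v p] offset_def by linarith
qed

lemma nu_suffix_F:
  assumes "v \<in> L" "p < K"
  shows "nu L \<mu> (suffix p (F v)) = nu L \<mu> v / K + offset (v 0) p"
proof -
  have "nu L \<mu> y = measure \<mu> (below y)" for y
    unfolding nu_def
    by (rule arg_cong[where f = "measure \<mu>"]) (use least_word_le[OF L_closed] in blast)
  thus ?thesis using measure_below_suffix_F[OF assms] by simp
qed

end

subsection \<open>Regular sequences\<close>

lemma sum_fun_eq: "(\<Sum>a\<in>A. f a) = (\<lambda>n. \<Sum>a\<in>A. f a n :: real)"
  by (induction A rule: infinite_finite_induct) (auto simp: fun_eq_iff)

text \<open>The span of \<open>s\<close> and finitely many scaled letter indicators of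
  \<open>w\<close> is stable under passing from \<open>f n\<close> to \<open>f (k * n + p)\<close>,
  so it contains the whole kernel.\<close>

lemma regular_seq_of_automatic_recurrence:
  fixes s :: "nat \<Rightarrow> real" and w :: "nat \<Rightarrow> 'a::finite" and c :: "'a \<Rightarrow> nat \<Rightarrow> real"
  assumes s_rec: "\<And>n p. p < k \<Longrightarrow> s (k * n + p) = s n / k + c (w n) p"
    and w_rec: "\<And>n p. p < k \<Longrightarrow> w (k * n + p) = h (w n) p"
  shows "regular_seq k s"
proof -
  \<comment> \<open>The real factor belongs to the generator, since scalars are rational and the
    values of \<open>c\<close> need not be. In \<open>B\<close> the letter \<open>b\<close> is
    independent of \<open>a\<close>, as substitution changes the letter tested but not the
    factor.\<close>
  define ind where "ind b x = (\<lambda>n. if w n = b then x else 0)" for b and x :: real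
  define B where "B = insert s ((\<lambda>(b, a, p). ind b (c a p)) ` (UNIV \<times> UNIV \<times> {..<k}))"
  have "finite B" by (simp add: B_def)
  have ind_B: "ind b (c a p) \<in> rat_seq.span B" if "p < k" for a b p
    using that by (intro rat_seq.span_base) (force simp: B_def)
  have sub: "(\<lambda>n. f (k * n + p)) \<in> rat_seq.span B" if f: "f \<in> rat_seq.span B" and p: "p < k" for f p
    using f
  proof (induction rule: rat_seq.span_induct_alt)
    case base
    show ?case using rat_seq.span_zero[of B] by (simp add: zero_fun_def)
  next
    case (step q x y)
    have "(\<lambda>n. x (k * n + p)) \<in> rat_seq.span B"
    proof (cases "x = s")
      case True
      have "(\<lambda>n. of_rat (1 / of_nat k) * s n) + (\<Sum>a\<in>UNIV. ind a (c a p)) \<in> rat_seq.span B"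
        by (intro rat_seq.span_add rat_seq.span_scale rat_seq.span_sum ind_B p rat_seq.span_base)
          (simp add: B_def)
      also have "(\<lambda>n. of_rat (1 / of_nat k) * s n) + (\<Sum>a\<in>UNIV. ind a (c a p))
          = (\<lambda>n. x (k * n + p))"
        unfolding True
        by (simp add: fun_eq_iff sum_fun_eq s_rec[OF p] ind_def of_rat_divide)
      finally show ?thesis .
    next
      case False
      then obtain b a p' where x: "x = ind b (c a p')" "p' < k"
        using step(1) by (auto simp: B_def)
      have "(\<Sum>b'\<in>{b'. h b' p = b}. ind b' (c a p')) \<in> rat_seq.span B"
        by (intro rat_seq.span_sum ind_B x)
      also have "(\<Sum>b'\<in>{b'. h b' p = b}. ind b' (c a p')) = (\<lambda>n. x (k * n + p))"
        by (simp add: fun_eq_iff sum_fun_eq w_rec[OF p] ind_def x)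
      finally show ?thesis .
    qed
    from rat_seq.span_add[OF rat_seq.span_scale[OF this, of q] step(2)]
    show ?case by (simp add: plus_fun_def)
  qed
  have "(\<lambda>n. s (k ^ e * n + j)) \<in> rat_seq.span B" if "j < k ^ e" for e j
    using that
  proof (induction e arbitrary: j)
    case 0
    thus ?case using rat_seq.span_base[of s B] by (simp add: B_def)
  next
    case (Suc e)
    have ke: "k ^ e > 0" using Suc.prems by (cases "k = 0") auto
    \<comment> \<open>The leading base-\<open>k\<close> digit of \<open>j\<close> is absorbed by
      \<open>sub\<close>, the remaining digits by the induction hypothesis.\<close>
    have "j div k ^ e < k" using Suc.prems ke by (simp add: div_less_iff_less_mult)
    from sub[OF Suc.IH this, of "j mod k ^ e"] ke
    have "(\<lambda>n. s (k ^ e * (k * n + j div k ^ e) + j mod k ^ e)) \<in> rat_seq.span B" by simp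
    also have "(\<lambda>n. s (k ^ e * (k * n + j div k ^ e) + j mod k ^ e)) = (\<lambda>n. s (k ^ Suc e * n + j))"
    proof -
      have "k ^ e * (k * n + j div k ^ e) + j mod k ^ e = k ^ Suc e * n + j" for n
        using mult_div_mod_eq[of "k ^ e" j] by (simp add: algebra_simps)
      thus ?thesis by simp
    qed
    finally show ?case .
  qed
  hence kernel: "kernel k s \<subseteq> rat_seq.span B" by (auto simp: kernel_def)
  \<comment> \<open>\<open>B\<close> may span more than the kernel does, while
    \<open>regular_seq\<close> asks for equal spans; a basis chosen inside the kernel is finite
    because it lies in the span of \<open>B\<close>.\<close>
  obtain D where D: "D \<subseteq> kernel k s" "rat_seq.independent D" "kernel k s \<subseteq> rat_seq.span D"
    using rat_seq.maximal_independent_subset .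
  have "finite D"
    using rat_seq.independent_span_bound[OF \<open>finite B\<close> D(2)] D(1) kernel by blast
  moreover have "rat_seq.span D = rat_seq.span (kernel k s)"
    using D by (metis rat_seq.span_mono rat_seq.span_minimal rat_seq.subspace_span subset_antisym)
  ultimately show ?thesis unfolding regular_seq_def by blast
qed

subsection \<open>Uniform morphisms\<close>

locale uniform_morph =
  fixes k :: nat and \<phi> :: "'a list \<Rightarrow> 'a list"
  assumes k_pos: "k > 0"
    and morphism: "morphism \<phi>"
    and uniform: "uniform_morphism k \<phi>"
begin

lemma length_\<phi>: "length (\<phi> xs) = k * length xs"
proof (induction xs)
  case Nil
  have "\<phi> ([] @ []) = \<phi> [] @ \<phi> []" using morphism unfolding morphism_def by blast
  thus ?case by simp
next
  case (Cons a xs)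
  have "\<phi> ([a] @ xs) = \<phi> [a] @ \<phi> xs" using morphism unfolding morphism_def by blast
  thus ?case using Cons uniform by (simp add: uniform_morphism_def)
qed

lemma \<phi>_prefix: "\<phi> (prefix n u) = prefix (k * n) (morph_word \<phi> u)"
proof -
  have "\<phi> [a] \<noteq> []" for a using length_\<phi>[of "[a]"] k_pos by auto
  from prefix_morph_word[OF morphism this, where n = n and u = u] show ?thesis
    by (simp add: length_\<phi> subsequence_def)
qed

text \<open>By uniformity the image of the first \<open>n\<close> letters has length
  \<open>k * n\<close>, so the image of the rest starts exactly there.\<close>

lemma morph_word_suffix: "morph_word \<phi> (suffix n u) = suffix (k * n) (morph_word \<phi> u)"
proof
  fix i
  let ?d = "Suc i"
  have "prefix (n + ?d) u = prefix n u @ prefix ?d (suffix n u)"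
    by (rule nth_equalityI) (auto simp: subsequence_def nth_append simp del: upt_Suc)
  hence "prefix (k * (n + ?d)) (morph_word \<phi> u)
      = prefix (k * n) (morph_word \<phi> u) @ prefix (k * ?d) (morph_word \<phi> (suffix n u))"
    using morphism unfolding morphism_def by (simp only: \<phi>_prefix[symmetric])
  moreover have "i < k * ?d" using k_pos by (cases k) auto
  moreover have "k * n + i < k * (n + ?d)"
    using \<open>i < k * ?d\<close> unfolding distrib_left by simp
  ultimately have "map (morph_word \<phi> u) [0..<k * (n + ?d)] ! (k * n + i)
      = (map (morph_word \<phi> u) [0..<k * n] @ map (morph_word \<phi> (suffix n u)) [0..<k * ?d]) ! (k * n + i)"
    by (simp only: subsequence_def)
  thus "morph_word \<phi> (suffix n u) i = suffix (k * n) (morph_word \<phi> u) i"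
    using \<open>i < k * ?d\<close> \<open>k * n + i < k * (n + ?d)\<close>
    by (simp add: nth_append del: upt_Suc mult_Suc_right add_Suc_right)
qed

lemma morph_word_first: "q < k \<Longrightarrow> morph_word \<phi> u q = \<phi> [u 0] ! q"
  using \<phi>_prefix[where n = 1 and u = u] by (simp add: subsequence_def)

lemma morph_word_nth: "morph_word \<phi> u i = \<phi> [u (i div k)] ! (i mod k)"
proof -
  have "morph_word \<phi> u i = morph_word \<phi> (suffix (i div k) u) (i mod k)"
    by (simp add: morph_word_suffix)
  thus ?thesis using morph_word_first k_pos by simp
qed

lemma funpow_prefix: "(\<phi> ^^ m) (prefix n u) = prefix (k ^ m * n) ((morph_word \<phi> ^^ m) u)"
  by (induction m) (simp_all add: \<phi>_prefix mult.assoc)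

text \<open>A factor of \<open>w\<close> at position \<open>j\<close> is mapped into a factor at
  position \<open>k * j\<close> of the image of \<open>w\<close>, which is \<open>w\<close>
  itself.\<close>

lemma orbit_closure_morph_word:
  assumes fixed: "morph_word \<phi> w = w" and u: "u \<in> orbit_closure w"
  shows "morph_word \<phi> u \<in> orbit_closure w"
  unfolding orbit_closure_iff
proof
  fix n
  obtain j where j: "\<forall>i<n. u i = w (j + i)" using u unfolding orbit_closure_iff by blast
  have "morph_word \<phi> u i = w (k * j + i)" if "i < n" for i
  proof -
    have "i div k < n" using that by (meson div_le_dividend le_less_trans)
    hence "morph_word \<phi> u i = morph_word \<phi> (suffix j w) i"
      using j by (simp add: morph_word_nth)
    thus ?thesis by (simp add: morph_word_suffix fixed)
  qed
  thus "\<exists>j. \<forall>i<n. morph_word \<phi> u i = w (j + i)" by blast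
qed

lemma primitive_occurs:
  assumes "primitive_morphism \<phi>"
  shows "\<exists>n. \<forall>a b. \<exists>q<k ^ n. (morph_word \<phi> ^^ n) (\<lambda>_. b) q = a"
proof -
  obtain n where n: "\<And>a b. a \<in> set ((\<phi> ^^ n) [b])"
    using assms unfolding primitive_morphism_def by blast
  have "\<exists>q<k ^ n. (morph_word \<phi> ^^ n) (\<lambda>_. b) q = a" for a b
    using n[of a b] funpow_prefix[where m = n and n = 1 and u = "\<lambda>_. b"] by (auto simp: subsequence_def)
  thus ?thesis by blast
qed

end

theorem lemma1:
  fixes k :: nat
    and \<phi> :: "'a::{finite, linorder} list \<Rightarrow> 'a list"
    and w :: "'a word"
    and \<mu> :: "'a word measure"
  defines "L \<equiv> orbit_closure w"
  assumes "k \<ge> 2"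
    and "morphism \<phi>"
    and "primitive_morphism \<phi>"
    and "morph_word \<phi> w = w"
    and "\<not> ultimately_periodic w"
    and "separable \<phi> L"
    and "order_preserving_on \<phi> L"
    and "invariant_prob L \<mu>"
    and "uniform_morphism k \<phi>"
  shows "regular_seq k (\<lambda>n. nu L \<mu> (suffix n w))"
proof -
  interpret uniform_morph k \<phi> using assms by unfold_locales auto
  let ?F = "morph_word \<phi>"
  have F_L: "?F u \<in> L" if "u \<in> L" for u
    using that orbit_closure_morph_word assms(5) unfolding L_def by blast
  have len: "length (\<phi> [a]) = k" for a using length_\<phi>[of "[a]"] by simp
  have L_suffix: "suffix n u \<in> L" if "u \<in> L" for n u
    using that orbit_closure_suffix unfolding L_def by blast
  have has_type: "has_type \<phi> L u" if "u \<in> L" for u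
    using assms(7) that unfolding separable_def by blast
  have ex1: "\<exists>!x. desubst \<phi> L u x" if "u \<in> L" for u
    using has_type[OF that] unfolding has_type_def .
  have desubst: "desubst \<phi> L x (u, p) \<longleftrightarrow> u \<in> L \<and> p < k \<and> x = suffix p (?F u)" for x u p
    by (simp add: desubst_def len)
  \<comment> \<open>Unique desubstitution resolves the definite description, so the type can be read
    off from any representation.\<close>
  have type_eq: "word_type \<phi> L (suffix p (?F u)) = (u 0, p)" if "u \<in> L" "p < k" for u p
  proof -
    have "(THE x. desubst \<phi> L (suffix p (?F u)) x) = (u, p)"
      by (rule the1_equality[OF ex1]) (use that desubst F_L L_suffix in auto)
    thus ?thesis by (simp add: word_type_def)
  qed
  have "{(a, p). p < length (\<phi> [a])} = UNIV \<times> {..<k}" by (auto simp: len)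
  then obtain r where r: "strict_linear_order_on (UNIV \<times> {..<k}) r"
    "\<And>u v. u \<in> L \<Longrightarrow> v \<in> L \<Longrightarrow> (word_type \<phi> L u, word_type \<phi> L v) \<in> r \<Longrightarrow> less_fun u v"
    using assms(7) unfolding separable_def by auto
  interpret ordered_desubstitution L \<mu> k ?F r
  proof unfold_locales
    show "invariant_prob L \<mu>" by fact
    show "cyl_closed L" unfolding L_def by (rule cyl_closed_orbit_closure)
    show "suffix n u \<in> L" if "u \<in> L" for n u by (rule L_suffix[OF that])
    show "0 < k" by (rule k_pos)
    show "?F u \<in> L" if "u \<in> L" for u by (rule F_L[OF that])
    show "?F u i = ?F v i" if "u (i div k) = v (i div k)" for u v i
      using that by (simp add: morph_word_nth)
    show "?F (suffix n u) = suffix (k * n) (?F u)" for n u by (rule morph_word_suffix)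
    show "\<exists>u\<in>L. \<exists>p<k. x = suffix p (?F u)" if "x \<in> L" for x
      using ex1[OF that] desubst by (metis surj_pair)
    show "u = v \<and> p = q" if "u \<in> L" "v \<in> L" "p < k" "q < k" "suffix p (?F u) = suffix q (?F v)"
      for u v p q
    proof -
      have "desubst \<phi> L (suffix p (?F u)) (u, p)" "desubst \<phi> L (suffix p (?F u)) (v, q)"
        using that desubst by auto
      thus ?thesis using ex1[OF L_suffix[OF F_L[OF that(1)]], of p] by blast
    qed
    show "2 \<le> k" by fact
    show "\<exists>n. \<forall>a b. \<exists>q<k ^ n. (?F ^^ n) (\<lambda>_. b) q = a"
      by (rule primitive_occurs) fact
    show "less_fun (?F u) (?F v) \<longleftrightarrow> less_fun u v" if "u \<in> L" "v \<in> L" for u v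
      using assms(8) that unfolding order_preserving_on_def by blast
    show "strict_linear_order_on (UNIV \<times> {..<k}) r" by (rule r)
    show "less_fun (suffix p (?F u)) (suffix q (?F v))"
      if "u \<in> L" "v \<in> L" "p < k" "q < k" "((u 0, p), (v 0, q)) \<in> r" for u v p q
      using that by (intro r(2)) (auto simp: type_eq intro: L_suffix F_L)
  qed
  show ?thesis
  proof (rule regular_seq_of_automatic_recurrence[where w = w and c = offset and h = "\<lambda>a p. \<phi> [a] ! p"])
    fix n p assume p: "p < k"
    have "suffix n w \<in> L" unfolding L_def by (rule suffix_in_orbit_closure)
    \<comment> \<open>Since \<open>w\<close> is fixed, applying the morphism to
      \<open>suffix n w\<close> and erasing \<open>p\<close> letters gives
      \<open>suffix (k * n + p) w\<close>.\<close>
    from nu_suffix_F[OF this p]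
    show "nu L \<mu> (suffix (k * n + p) w) = nu L \<mu> (suffix n w) / k + offset (w n) p"
      by (simp add: morph_word_suffix assms(5))
    show "w (k * n + p) = \<phi> [w n] ! p"
      using morph_word_nth[of w "k * n + p"] p assms(5) by simp
  qed
qed

end
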